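(* Let $r\geq 2$ and let $Z=\{p_1,\ldots,p_s\}$ and $Z'=\{p_1',\ldots,p_s'\}$ be reduced sets of $s$ points in $\mathbb{P}^r$ (that is, each consists of $s$ distinct points). Then there exists a birational map $\omega:\mathbb{P}^r\dashrightarrow\mathbb{P}^r$ such that $\omega$ is an isomorphism in a neighborhood of $Z$ and $\omega(Z)=Z'$.
   Context: We work over the field of complex numbers $\mathbb{C}$. That $\omega$ is an isomorphism in a neighborhood of $Z$ means that there is an open subset of $\mathbb{P}^r$ containing $Z$ on which $\omega$ is defined and restricts to an isomorphism onto an open subset of $\mathbb{P}^r$. *)

theory Defs
  imports "HOL-Analysis.Analysis" "HOL-Library.Poly_Mapping"
begin

section \<open>Homogeneous polynomials\<close>

text \<open>
  Polynomials over the complex numbers in variables indexed by the finite type \<open>'n\<close>,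
  as finitely supported functions from exponent vectors to coefficients.
\<close>

type_synonym 'n mpoly = "('n \<Rightarrow>\<^sub>0 nat) \<Rightarrow>\<^sub>0 complex"

definition eval_monom :: "('n::finite \<Rightarrow>\<^sub>0 nat) \<Rightarrow> complex ^ 'n \<Rightarrow> complex" where
  "eval_monom m v = (\<Prod>i\<in>UNIV. (v $ i) ^ Poly_Mapping.lookup m i)"

definition eval_mpoly :: "'n::finite mpoly \<Rightarrow> complex ^ 'n \<Rightarrow> complex" where
  "eval_mpoly p v = (\<Sum>m\<in>Poly_Mapping.keys p. Poly_Mapping.lookup p m * eval_monom m v)"

text \<open>The zero polynomial is homogeneous of every degree.\<close>

definition homogeneous :: "nat \<Rightarrow> 'n::finite mpoly \<Rightarrow> bool" where
  "homogeneous d p \<longleftrightarrow> (\<forall>m\<in>Poly_Mapping.keys p. (\<Sum>i\<in>UNIV. Poly_Mapping.lookup m i) = d)"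

lemma eval_mpoly_superset:
  assumes "finite A" "Poly_Mapping.keys p \<subseteq> A"
  shows "eval_mpoly p v = (\<Sum>m\<in>A. Poly_Mapping.lookup p m * eval_monom m v)"
  unfolding eval_mpoly_def
  by (rule sum.mono_neutral_left) (use assms in \<open>auto simp: in_keys_iff\<close>)

lemma eval_mpoly_add: "eval_mpoly (p + q) v = eval_mpoly p v + eval_mpoly q v"
proof -
  let ?A = "Poly_Mapping.keys p \<union> Poly_Mapping.keys q"
  have "eval_mpoly (p + q) v = (\<Sum>m\<in>?A. Poly_Mapping.lookup (p + q) m * eval_monom m v)"
    by (rule eval_mpoly_superset) (auto dest: subsetD[OF keys_add])
  also have "\<dots> = (\<Sum>m\<in>?A. Poly_Mapping.lookup p m * eval_monom m v) + (\<Sum>m\<in>?A. Poly_Mapping.lookup q m * eval_monom m v)"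
    by (simp add: lookup_add distrib_right sum.distrib)
  also have "\<dots> = eval_mpoly p v + eval_mpoly q v"
    by (simp add: eval_mpoly_superset[of ?A])
  finally show ?thesis .
qed

lemma eval_mpoly_zero: "eval_mpoly 0 v = 0"
  by (simp add: eval_mpoly_def)

lemma eval_mpoly_sum: "eval_mpoly (\<Sum>a\<in>A. f a) v = (\<Sum>a\<in>A. eval_mpoly (f a) v)"
  by (induction A rule: infinite_finite_induct) (simp_all add: eval_mpoly_zero eval_mpoly_add)

lemma eval_mpoly_single: "eval_mpoly (Poly_Mapping.single m c) v = c * eval_monom m v"
  by (subst eval_mpoly_superset[of "{m}"]) auto

lemma eval_monom_add: "eval_monom (m + m') v = eval_monom m v * eval_monom m' v"
  by (simp add: eval_monom_def lookup_add power_add prod.distrib)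

lemma mpoly_eq_sum_single: "p = (\<Sum>m\<in>Poly_Mapping.keys p. Poly_Mapping.single m (Poly_Mapping.lookup p m))"
  by (rule poly_mapping_eqI) (auto simp: lookup_sum lookup_single when_def in_keys_iff)

lemma eval_mpoly_mult: "eval_mpoly (p * q) v = eval_mpoly p v * eval_mpoly q v"
proof -
  have "p * q = (\<Sum>m\<in>Poly_Mapping.keys p. \<Sum>m'\<in>Poly_Mapping.keys q. Poly_Mapping.single (m + m') (Poly_Mapping.lookup p m * Poly_Mapping.lookup q m'))"
    by (subst mpoly_eq_sum_single[of p], subst mpoly_eq_sum_single[of q])
       (simp add: sum_product mult_single)
  then have "eval_mpoly (p * q) v
      = (\<Sum>m\<in>Poly_Mapping.keys p. \<Sum>m'\<in>Poly_Mapping.keys q. Poly_Mapping.lookup p m * Poly_Mapping.lookup q m' * (eval_monom m v * eval_monom m' v))"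
    by (simp add: eval_mpoly_sum eval_mpoly_single eval_monom_add)
  also have "\<dots> = eval_mpoly p v * eval_mpoly q v"
    unfolding eval_mpoly_def sum_product by (simp add: mult_ac)
  finally show ?thesis .
qed

lemma homogeneous_mult:
  assumes "homogeneous d p" "homogeneous e q"
  shows "homogeneous (d + e) (p * q)"
  using assms keys_mult[of p q]
  by (fastforce simp: homogeneous_def lookup_add sum.distrib)


section \<open>Projective space\<close>

definition proj_rel :: "complex ^ 'n \<Rightarrow> complex ^ 'n \<Rightarrow> bool" where
  "proj_rel v w \<longleftrightarrow> v \<noteq> 0 \<and> w \<noteq> 0 \<and> (\<exists>c. c \<noteq> 0 \<and> w = c *s v)"

text \<open>
  The points of \<open>'n proj\<close> are the nonzero vectors modulo scaling.  There are \<open>CARD('n)\<close>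
  homogeneous coordinates, so this is projective space of dimension \<open>CARD('n) - 1\<close>.
\<close>

quotient_type (overloaded) 'n proj = "complex ^ ('n::finite)" / partial: proj_rel
proof (rule part_equivpI)
  show "\<exists>v :: complex ^ 'n. proj_rel v v"
    by (rule exI[of _ "\<chi> i. 1"]) (auto simp: proj_rel_def vec_eq_iff intro!: exI[of _ 1])
  show "symp (proj_rel :: complex ^ 'n \<Rightarrow> _)"
  proof (rule sympI)
    fix v w :: "complex ^ 'n"
    assume "proj_rel v w"
    then obtain c where c: "v \<noteq> 0" "w \<noteq> 0" "c \<noteq> 0" "w = c *s v"
      by (auto simp: proj_rel_def)
    then have "v = inverse c *s w"
      by (simp add: vector_smult_assoc)
    with c show "proj_rel w v"
      unfolding proj_rel_def by (metis inverse_nonzero_iff_nonzero)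
  qed
  show "transp (proj_rel :: complex ^ 'n \<Rightarrow> _)"
    unfolding proj_rel_def by (rule transpI) (metis mult_eq_0_iff vector_smult_assoc)
qed

definition hom_coords :: "'n::finite proj \<Rightarrow> (complex ^ 'n) set" where
  "hom_coords P = {v. v \<noteq> 0 \<and> abs_proj v = P}"

definition zero_locus :: "'n::finite mpoly set \<Rightarrow> 'n proj set" where
  "zero_locus S = {P. \<forall>f\<in>S. \<forall>v\<in>hom_coords P. eval_mpoly f v = 0}"

definition zariski_open :: "'n::finite proj set \<Rightarrow> bool" where
  "zariski_open U \<longleftrightarrow> (\<exists>S. (\<forall>f\<in>S. \<exists>d. homogeneous d f) \<and> U = - zero_locus S)"

definition zariski :: "'n::finite proj topology" where
  "zariski = topology zariski_open"

lemma hom_coords_iff: "v \<in> hom_coords P \<longleftrightarrow> v \<noteq> 0 \<and> abs_proj v = P"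
  by (simp add: hom_coords_def)

lemma abs_proj_eq_iff:
  assumes "v \<noteq> 0" "w \<noteq> 0"
  shows "abs_proj v = abs_proj w \<longleftrightarrow> (\<exists>c. c \<noteq> 0 \<and> w = c *s v)"
proof -
  have "proj_rel u u" if "u \<noteq> 0" for u :: "complex ^ 'a"
    using that by (auto simp: proj_rel_def intro!: exI[of _ 1])
  then show ?thesis
    using Quotient_rel[OF Quotient_proj, of v w] assms by (auto simp: proj_rel_def)
qed

lemma hom_coords_nonempty: "\<exists>v. v \<in> hom_coords P"
proof -
  have "proj_rel (rep_proj P) (rep_proj P)"
    by (rule Quotient_rep_reflp[OF Quotient_proj])
  moreover have "abs_proj (rep_proj P) = P"
    by (rule Quotient_abs_rep[OF Quotient_proj])
  ultimately show ?thesis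
    by (auto simp: hom_coords_def proj_rel_def)
qed

lemma eval_monom_scale: "eval_monom m (c *s v) = c ^ (\<Sum>i\<in>UNIV. Poly_Mapping.lookup m i) * eval_monom m v"
  by (simp add: eval_monom_def power_mult_distrib prod.distrib power_sum)

lemma eval_mpoly_scale:
  assumes "homogeneous d p"
  shows "eval_mpoly p (c *s v) = c ^ d * eval_mpoly p v"
  using assms
  by (auto simp: eval_mpoly_def homogeneous_def eval_monom_scale sum_distrib_left mult_ac
           intro!: sum.cong)

lemma zero_locus_at:
  assumes "\<forall>f\<in>S. \<exists>d. homogeneous d f" "v \<in> hom_coords P"
  shows "P \<in> zero_locus S \<longleftrightarrow> (\<forall>f\<in>S. eval_mpoly f v = 0)"
proof -
  have "eval_mpoly f w = 0" if f: "f \<in> S" and 0: "eval_mpoly f v = 0" and w: "w \<in> hom_coords P" for f w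
  proof -
    have "v \<noteq> 0" "w \<noteq> 0" "abs_proj v = abs_proj w"
      using w assms(2) by (auto simp: hom_coords_def)
    then obtain c where "w = c *s v"
      by (auto simp: abs_proj_eq_iff)
    with assms(1) f 0 show ?thesis
      by (auto simp: eval_mpoly_scale)
  qed
  with assms(2) show ?thesis
    unfolding zero_locus_def by blast
qed

lemma istopology_zariski: "istopology zariski_open"
  unfolding istopology_def
proof (intro conjI allI impI)
  fix U V :: "'a proj set"
  assume "zariski_open U" "zariski_open V"
  then obtain S T where S: "\<forall>f\<in>S. \<exists>d. homogeneous d f" "U = - zero_locus S"
    and T: "\<forall>f\<in>T. \<exists>d. homogeneous d f" "V = - zero_locus T"
    by (auto simp: zariski_open_def)
  define R where "R = {f * g | f g. f \<in> S \<and> g \<in> T}"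
  have R: "\<forall>f\<in>R. \<exists>d. homogeneous d f"
    unfolding R_def using S(1) T(1) by (blast intro: homogeneous_mult)
  have "P \<in> zero_locus R \<longleftrightarrow> P \<in> zero_locus S \<or> P \<in> zero_locus T" for P
  proof -
    obtain v where v: "v \<in> hom_coords P"
      using hom_coords_nonempty by blast
    have "(\<forall>h\<in>R. eval_mpoly h v = 0)
        \<longleftrightarrow> (\<forall>f\<in>S. eval_mpoly f v = 0) \<or> (\<forall>g\<in>T. eval_mpoly g v = 0)"
      by (auto simp: R_def eval_mpoly_mult) (metis eval_mpoly_mult mult_eq_0_iff)
    then show ?thesis
      using zero_locus_at[OF R v] zero_locus_at[OF S(1) v] zero_locus_at[OF T(1) v] by simp
  qed
  then have "U \<inter> V = - zero_locus R"
    using S(2) T(2) by blast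
  with R show "zariski_open (U \<inter> V)"
    unfolding zariski_open_def by blast
next
  fix K :: "'a proj set set"
  assume "\<forall>U\<in>K. zariski_open U"
  then obtain S where S: "\<forall>U\<in>K. (\<forall>f\<in>S U. \<exists>d. homogeneous d f) \<and> U = - zero_locus (S U)"
    unfolding zariski_open_def by metis
  have "zero_locus (\<Union>U\<in>K. S U) = (\<Inter>U\<in>K. zero_locus (S U))"
    by (auto simp: zero_locus_def)
  also have "\<dots> = (\<Inter>U\<in>K. - U)"
    using S by blast
  finally have "\<Union>K = - zero_locus (\<Union>U\<in>K. S U)"
    by blast
  with S show "zariski_open (\<Union>K)"
    unfolding zariski_open_def by blast
qed

lemma openin_zariski: "openin zariski U \<longleftrightarrow> zariski_open U"
  by (simp add: zariski_def topology_inverse'[OF istopology_zariski])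

lemma topspace_zariski: "topspace zariski = UNIV"
proof -
  have "homogeneous 0 (1 :: 'a mpoly)"
    by (simp add: homogeneous_def)
  moreover have "zero_locus {1 :: 'a mpoly} = {}"
  proof -
    have "eval_mpoly (1 :: 'a mpoly) v = 1" for v
      by (simp add: eval_mpoly_def eval_monom_def)
    with hom_coords_nonempty show ?thesis
      by (auto simp: zero_locus_def)
  qed
  ultimately have "zariski_open (UNIV :: 'a proj set)"
    unfolding zariski_open_def by (intro exI[of _ "{1}"]) auto
  then show ?thesis
    by (metis openin_zariski openin_subset top.extremum_uniqueI)
qed


section \<open>Morphisms and rational maps\<close>

text \<open>
  \<open>f\<close> is a morphism from \<open>U\<close> to projective space: locally in the Zariski topology it is given by
  homogeneous polynomials of a common degree without common zeros.  The absence of common zeros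
  is contained in \<open>hom_coords\<close>, whose members are nonzero.  Values of \<open>f\<close> outside \<open>U\<close> are
  irrelevant.
\<close>

definition regular_on :: "'n::finite proj set \<Rightarrow> ('n proj \<Rightarrow> 'n proj) \<Rightarrow> bool" where
  "regular_on U f \<longleftrightarrow>
    (\<forall>P\<in>U. \<exists>V d F. openin zariski V \<and> P \<in> V \<and> V \<subseteq> U \<and>
       (\<forall>i. homogeneous d (F i)) \<and>
       (\<forall>Q\<in>V. \<forall>v\<in>hom_coords Q. (\<chi> i. eval_mpoly (F i) v) \<in> hom_coords (f Q)))"

definition isomorphism_between ::
    "'n::finite proj set \<Rightarrow> 'n proj set \<Rightarrow> ('n proj \<Rightarrow> 'n proj) \<Rightarrow> bool" where
  "isomorphism_between U V f \<longleftrightarrow>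
    regular_on U f \<and> f ` U \<subseteq> V \<and>
    (\<exists>g. regular_on V g \<and> g ` V \<subseteq> U \<and> (\<forall>P\<in>U. g (f P) = P) \<and> (\<forall>Q\<in>V. f (g Q) = Q))"

text \<open>
  A rational map is an equivalence class of pairs \<open>(U, f)\<close>, with \<open>U\<close> nonempty and open and \<open>f\<close> a
  morphism on \<open>U\<close>, where two pairs are identified if the morphisms agree on the common domain.
\<close>

type_synonym 'n rat_map = "('n proj set \<times> ('n proj \<Rightarrow> 'n proj)) set"

definition rat_pairs :: "('n::finite proj set \<times> ('n proj \<Rightarrow> 'n proj)) set" where
  "rat_pairs = {(U, f). openin zariski U \<and> U \<noteq> {} \<and> regular_on U f}"

definition rat_eq ::
    "(('n::finite proj set \<times> ('n proj \<Rightarrow> 'n proj)) \<times> ('n proj set \<times> ('n proj \<Rightarrow> 'n proj))) set" where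
  "rat_eq = {((U, f), (V, g)).
     (U, f) \<in> rat_pairs \<and> (V, g) \<in> rat_pairs \<and> (\<forall>P\<in>U \<inter> V. f P = g P)}"

definition rational_maps :: "'n::finite rat_map set" where
  "rational_maps = rat_pairs // rat_eq"

definition rat_id :: "'n::finite rat_map" where
  "rat_id = rat_eq `` {(UNIV, id)}"

definition dominant :: "'n::finite rat_map \<Rightarrow> bool" where
  "dominant \<omega> \<longleftrightarrow> (\<forall>(U, f)\<in>\<omega>. zariski closure_of (f ` U) = UNIV)"

text \<open>
  The composite of \<open>\<omega>\<close> followed by \<open>\<eta>\<close>, for dominant \<open>\<omega>\<close>: the class of all the
  pairs \<open>(U \<inter> f -` V, g \<circ> f)\<close> obtained from representatives \<open>(U, f)\<close> of \<open>\<omega>\<close> and \<open>(V, g)\<close> of \<open>\<eta>\<close>.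
\<close>

definition rat_comp :: "'n::finite rat_map \<Rightarrow> 'n rat_map \<Rightarrow> 'n rat_map" where
  "rat_comp \<eta> \<omega> = (\<Union>(U, f)\<in>\<omega>. \<Union>(V, g)\<in>\<eta>. rat_eq `` {(U \<inter> f -` V, g \<circ> f)})"

definition birational_map :: "'n::finite rat_map \<Rightarrow> bool" where
  "birational_map \<omega> \<longleftrightarrow> \<omega> \<in> rational_maps \<and> dominant \<omega> \<and>
    (\<exists>\<eta>\<in>rational_maps. dominant \<eta> \<and> rat_comp \<eta> \<omega> = rat_id \<and> rat_comp \<omega> \<eta> = rat_id)"

definition isomorphism_near :: "'n::finite rat_map \<Rightarrow> 'n proj set \<Rightarrow> bool" where
  "isomorphism_near \<omega> Z \<longleftrightarrow>
    (\<exists>U f V. openin zariski U \<and> Z \<subseteq> U \<and> (U, f) \<in> \<omega> \<and>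
       openin zariski V \<and> isomorphism_between U V f)"

text \<open>The set of values of \<open>\<omega>\<close> at those points of \<open>Z\<close> where it is defined.\<close>

definition rat_image :: "'n::finite rat_map \<Rightarrow> 'n proj set \<Rightarrow> 'n proj set" where
  "rat_image \<omega> Z = (\<Union>(U, f)\<in>\<omega>. f ` (U \<inter> Z))"

end

theory Submission
  imports Defs
begin

text \<open>
  Choose a hyperplane \<open>l = 0\<close> missing \<open>Z \<union> Z'\<close>; it suffices to move \<open>Z\<close> to \<open>Z'\<close> by a polynomial
  automorphism of the affine complement \<open>A\<close>.  If \<open>l e = 0\<close> and \<open>q\<close> is a form of degree \<open>d + 1\<close>
  invariant under translation by \<open>e\<close>, the shear \<open>v \<mapsto> l(v)\<^sup>d v + q(v) e\<close> is an automorphism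
  of \<open>A\<close>, with inverse given by \<open>-q\<close>.  A shear in direction \<open>c - a\<close> moves \<open>a\<close> to \<open>c\<close> and fixes any
  finite set off the line through \<open>a\<close> and \<open>c\<close>.  Since \<open>r \<ge> 2\<close>, a point \<open>a\<close> can be moved to \<open>b\<close>
  through a generic third point \<open>c\<close> while a finite set not containing \<open>a\<close> and \<open>b\<close> stays fixed, so
  the points of \<open>Z\<close> can be replaced by those of \<open>Z'\<close> one at a time.
\<close>

section \<open>Homogeneous polynomial functions\<close>

text \<open>Stated for functions, so that products, powers and substitutions can be written
  directly. The degree is a parameter because the zero function is a form of every degree.\<close>

definition hform :: "nat \<Rightarrow> (complex ^ 'n::finite \<Rightarrow> complex) \<Rightarrow> bool" where
  "hform d f \<longleftrightarrow> (\<exists>p. homogeneous d p \<and> f = eval_mpoly p)"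

lemma homogeneous_add: "homogeneous d p \<Longrightarrow> homogeneous d q \<Longrightarrow> homogeneous d (p + q)"
  using keys_add[of p q] by (auto simp: homogeneous_def)

lemma hform_0: "hform d (\<lambda>_. 0)"
  unfolding hform_def by (intro exI[of _ 0]) (auto simp: homogeneous_def eval_mpoly_zero)

lemma hform_const: "hform 0 (\<lambda>_. c)"
  unfolding hform_def
  by (intro exI[of _ "Poly_Mapping.single 0 c"])
     (auto simp: homogeneous_def eval_mpoly_single eval_mpoly_zero eval_monom_def fun_eq_iff)

lemma hform_coord: "hform 1 (\<lambda>v. v $ i)"
  unfolding hform_def
proof (intro exI conjI)
  let ?p = "Poly_Mapping.single (Poly_Mapping.single i (1::nat)) (1::complex)"
  show "homogeneous 1 ?p"
    by (auto simp: homogeneous_def lookup_single when_def)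
  have "eval_monom (Poly_Mapping.single i 1) v = (\<Prod>j\<in>UNIV. if j = i then v $ j else 1)" for v
    unfolding eval_monom_def by (rule prod.cong) (auto simp: lookup_single when_def)
  then show "(\<lambda>v. v $ i) = eval_mpoly ?p"
    by (auto simp: eval_mpoly_single)
qed

lemma hform_add: "hform d f \<Longrightarrow> hform d g \<Longrightarrow> hform d (\<lambda>v. f v + g v)"
proof -
  assume "hform d f" "hform d g"
  then obtain p q where "homogeneous d p" "f = eval_mpoly p" "homogeneous d q" "g = eval_mpoly q"
    by (auto simp: hform_def)
  then show ?thesis
    unfolding hform_def
    by (intro exI[of _ "p + q"]) (auto simp: homogeneous_add eval_mpoly_add)
qed

lemma hform_sum: "(\<And>i. i \<in> I \<Longrightarrow> hform d (f i)) \<Longrightarrow> hform d (\<lambda>v. \<Sum>i\<in>I. f i v)"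
  by (induction I rule: infinite_finite_induct) (auto simp: hform_0 intro!: hform_add)

lemma hform_mult: "hform d f \<Longrightarrow> hform e g \<Longrightarrow> hform (d + e) (\<lambda>v. f v * g v)"
proof -
  assume "hform d f" "hform e g"
  then obtain p q where "homogeneous d p" "f = eval_mpoly p" "homogeneous e q" "g = eval_mpoly q"
    by (auto simp: hform_def)
  then show ?thesis
    unfolding hform_def
    by (intro exI[of _ "p * q"]) (auto simp: homogeneous_mult eval_mpoly_mult)
qed

lemma hform_cmult: "hform d f \<Longrightarrow> hform d (\<lambda>v. c * f v)"
  using hform_mult[OF hform_const] by fastforce

lemma hform_prod:
  "(\<And>i. i \<in> I \<Longrightarrow> hform (d i) (f i)) \<Longrightarrow> hform (\<Sum>i\<in>I. d i) (\<lambda>v. \<Prod>i\<in>I. f i v)"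
  by (induction I rule: infinite_finite_induct) (auto intro!: hform_mult hform_const)

lemma hform_power: "hform d f \<Longrightarrow> hform (d * k) (\<lambda>v. f v ^ k)"
  using hform_prod[of "{..<k}" "\<lambda>_. d" "\<lambda>_. f"] by (simp add: mult.commute)

lemma hform_scale: "hform d f \<Longrightarrow> f (c *s v) = c ^ d * f v"
  by (auto simp: hform_def eval_mpoly_scale)

text \<open>Substitution turns each monomial of degree \<open>e\<close> into a product of
  \<open>e\<close> forms of degree \<open>d\<close>, counted with multiplicity.\<close>

lemma hform_compose:
  assumes "hform e g" "\<And>i. hform d (F i)"
  shows "hform (d * e) (\<lambda>v. g (\<chi> i. F i v))"
proof -
  obtain p where p: "homogeneous e p" "g = eval_mpoly p"
    using assms(1) by (auto simp: hform_def)
  have "hform (d * e) (\<lambda>v. Poly_Mapping.lookup p m * (\<Prod>i\<in>UNIV. F i v ^ Poly_Mapping.lookup m i))"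
    if m: "m \<in> Poly_Mapping.keys p" for m
  proof -
    have "d * e = (\<Sum>i\<in>UNIV. d * Poly_Mapping.lookup m i)"
      using p(1) m by (auto simp: homogeneous_def sum_distrib_left[symmetric])
    then show ?thesis
      by (simp only:) (intro hform_cmult hform_prod hform_power assms(2))
  qed
  then show ?thesis
    unfolding p(2) eval_mpoly_def eval_monom_def by (auto intro!: hform_sum)
qed

lemma hform_on_line:
  assumes "hform d f"
  shows "\<exists>p. \<forall>t. poly p t = f (v + t *s w)"
proof -
  obtain q where q: "f = eval_mpoly q"
    using assms by (auto simp: hform_def)
  show ?thesis
    by (rule exI[of _ "\<Sum>m\<in>Poly_Mapping.keys q. smult (Poly_Mapping.lookup q m)
              (\<Prod>i\<in>UNIV. [:v $ i, w $ i:] ^ Poly_Mapping.lookup m i)"])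
       (simp add: q eval_mpoly_def eval_monom_def poly_sum poly_prod)
qed

text \<open>On the line through the two given points, \<open>f\<close> and \<open>g\<close> become nonzero univariate polynomials.\<close>

lemma hform_common_nonzero:
  assumes "hform d f" "hform e g" "f v \<noteq> 0" "g w \<noteq> 0"
  shows "\<exists>u. f u \<noteq> 0 \<and> g u \<noteq> 0"
proof -
  obtain p q where p: "\<And>t. poly p t = f (v + t *s (w - v))"
    and q: "\<And>t. poly q t = g (v + t *s (w - v))"
    using hform_on_line assms(1,2) by metis
  have "poly p 0 \<noteq> 0" "poly q 1 \<noteq> 0"
    using assms(3,4) by (auto simp: p q)
  then have "p * q \<noteq> 0"
    by auto
  then have "finite {t. poly (p * q) t = 0}"
    by (rule poly_roots_finite)
  then obtain t where "poly (p * q) t \<noteq> 0"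
    using ex_new_if_finite[OF infinite_UNIV_char_0] by blast
  then show ?thesis
    by (auto simp: p q)
qed

text \<open>Induction: the product of the forms already treated is again a form, so the case of two
  forms applies. The generic choices of vectors below rest on this.\<close>

lemma hform_finite_common_nonzero:
  assumes "finite I" "\<And>i. i \<in> I \<Longrightarrow> hform (d i) (f i)" "\<And>i. i \<in> I \<Longrightarrow> \<exists>v. f i v \<noteq> 0"
  shows "\<exists>v. \<forall>i\<in>I. f i v \<noteq> 0"
  using assms
proof (induction I)
  case (insert i I)
  then obtain v w where v: "\<forall>j\<in>I. f j v \<noteq> 0" and w: "f i w \<noteq> 0"
    by fastforce
  have "hform (\<Sum>j\<in>I. d j) (\<lambda>v. \<Prod>j\<in>I. f j v)" "hform (d i) (f i)"
    using insert.prems by (auto intro: hform_prod)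
  moreover have "(\<Prod>j\<in>I. f j v) \<noteq> 0"
    using v \<open>finite I\<close> by simp
  ultimately obtain u where "(\<Prod>j\<in>I. f j u) \<noteq> 0" "f i u \<noteq> 0"
    using hform_common_nonzero[of _ _ _ _ v w] w by blast
  then show ?case
    using \<open>finite I\<close> by auto
qed auto


section \<open>The Zariski topology\<close>

text \<open>Meant for forms \<open>f\<close>, where any one representative of \<open>P\<close>
  decides membership.\<close>

definition basic_open :: "(complex ^ 'n::finite \<Rightarrow> complex) \<Rightarrow> 'n proj set" where
  "basic_open f = {P. \<exists>v\<in>hom_coords P. f v \<noteq> 0}"

lemma hom_coords_abs_proj: "v \<noteq> 0 \<Longrightarrow> v \<in> hom_coords (abs_proj v)"
  by (simp add: hom_coords_iff)

lemma hom_coords_smult: "v \<in> hom_coords P \<Longrightarrow> c \<noteq> 0 \<Longrightarrow> c *s v \<in> hom_coords P"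
  by (metis abs_proj_eq_iff hom_coords_iff vec.scale_eq_0_iff)

lemma hom_coordsE:
  assumes "v \<in> hom_coords P" "w \<in> hom_coords P"
  obtains c where "c \<noteq> 0" "w = c *s v"
  using assms by (metis abs_proj_eq_iff hom_coords_iff)

lemma hom_coords_unique: "v \<in> hom_coords P \<Longrightarrow> v \<in> hom_coords Q \<Longrightarrow> P = Q"
  by (simp add: hom_coords_iff)

lemma in_basic_open:
  assumes "hform d f" "v \<in> hom_coords P"
  shows "P \<in> basic_open f \<longleftrightarrow> f v \<noteq> 0"
proof
  assume "P \<in> basic_open f"
  then obtain w where w: "w \<in> hom_coords P" "f w \<noteq> 0"
    by (auto simp: basic_open_def)
  obtain c where "w = c *s v"
    using assms(2) w(1) by (rule hom_coordsE)
  with w show "f v \<noteq> 0"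
    using hform_scale[OF assms(1)] by auto
qed (use assms in \<open>auto simp: basic_open_def\<close>)

lemma openin_basic_open:
  assumes "hform d f"
  shows "openin zariski (basic_open f)"
proof -
  obtain p where "homogeneous d p" "f = eval_mpoly p"
    using assms by (auto simp: hform_def)
  then show ?thesis
    unfolding openin_zariski zariski_open_def
    by (intro exI[of _ "{p}"]) (auto simp: zero_locus_def basic_open_def)
qed

lemma zariski_basis:
  assumes "openin zariski U" "P \<in> U"
  obtains d f where "hform d f" "P \<in> basic_open f" "basic_open f \<subseteq> U"
proof -
  obtain S where S: "\<forall>p\<in>S. \<exists>d. homogeneous d p" "U = - zero_locus S"
    using assms(1) by (auto simp: openin_zariski zariski_open_def)
  then obtain p v where p: "p \<in> S" "v \<in> hom_coords P" "eval_mpoly p v \<noteq> 0"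
    using assms(2) by (auto simp: zero_locus_def)
  then obtain d where "homogeneous d p"
    using S(1) by blast
  show thesis
  proof
    show "hform d (eval_mpoly p)"
      using \<open>homogeneous d p\<close> by (auto simp: hform_def)
    show "P \<in> basic_open (eval_mpoly p)" "basic_open (eval_mpoly p) \<subseteq> U"
      using p S(2) by (auto simp: basic_open_def zero_locus_def)
  qed
qed

text \<open>Nonempty open sets contain nonempty basic ones, given by forms that are not identically
  zero, and two such forms are nonzero at a common vector.\<close>

lemma zariski_irreducible:
  fixes U V :: "'n::finite proj set"
  assumes "openin zariski U" "openin zariski V" "U \<noteq> {}" "V \<noteq> {}"
  shows "U \<inter> V \<noteq> {}"
proof -
  obtain P Q where PQ: "P \<in> U" "Q \<in> V"
    using assms by auto
  obtain d f where f: "hform d f" "P \<in> basic_open f" "basic_open f \<subseteq> U"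
    using zariski_basis assms(1) PQ(1) .
  obtain e g where g: "hform e g" "Q \<in> basic_open g" "basic_open g \<subseteq> V"
    using zariski_basis assms(2) PQ(2) .
  obtain v w where v: "v \<noteq> 0" "f v \<noteq> 0" and w: "g w \<noteq> 0"
    using f(2) g(2) by (auto simp: basic_open_def hom_coords_iff)
  \<comment> \<open>A coordinate is kept nonzero too, since forms of degree 0 may be nonzero at the
    zero vector, which represents no point.\<close>
  obtain i where i: "v $ i \<noteq> 0"
    using v(1) by (auto simp: vec_eq_iff)
  obtain u where "f u * g u \<noteq> 0" "u $ i \<noteq> 0"
    using hform_common_nonzero[OF hform_mult[OF f(1) g(1)] hform_coord] i
      hform_common_nonzero[OF f(1) g(1) v(2) w] by (metis mult_eq_0_iff)
  then have "u \<noteq> 0" "f u \<noteq> 0" "g u \<noteq> 0"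
    by auto
  then have "abs_proj u \<in> U \<inter> V"
    using f g in_basic_open hom_coords_abs_proj by blast
  then show ?thesis
    by blast
qed


section \<open>Regular maps\<close>

lemma regular_on_hform:
  "regular_on U f \<longleftrightarrow>
    (\<forall>P\<in>U. \<exists>V d F. openin zariski V \<and> P \<in> V \<and> V \<subseteq> U \<and> (\<forall>i. hform d (F i)) \<and>
       (\<forall>Q\<in>V. \<forall>v\<in>hom_coords Q. (\<chi> i. F i v) \<in> hom_coords (f Q)))"
  unfolding regular_on_def
proof (intro ball_cong refl iffI; elim exE conjE)
  fix P V d and F :: "_ \<Rightarrow> 'a mpoly"
  assume "openin zariski V" "P \<in> V" "V \<subseteq> U" "\<forall>i. homogeneous d (F i)"
    "\<forall>Q\<in>V. \<forall>v\<in>hom_coords Q. (\<chi> i. eval_mpoly (F i) v) \<in> hom_coords (f Q)"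
  then show "\<exists>V d F. openin zariski V \<and> P \<in> V \<and> V \<subseteq> U \<and> (\<forall>i. hform d (F i)) \<and>
       (\<forall>Q\<in>V. \<forall>v\<in>hom_coords Q. (\<chi> i. F i v) \<in> hom_coords (f Q))"
    by (intro exI[of _ V] exI[of _ d] exI[of _ "\<lambda>i. eval_mpoly (F i)"]) (auto simp: hform_def)
next
  fix P V d and F :: "_ \<Rightarrow> complex ^ 'a \<Rightarrow> complex"
  assume *: "openin zariski V" "P \<in> V" "V \<subseteq> U" "\<forall>i. hform d (F i)"
    "\<forall>Q\<in>V. \<forall>v\<in>hom_coords Q. (\<chi> i. F i v) \<in> hom_coords (f Q)"
  then obtain G where "\<forall>i. homogeneous d (G i) \<and> F i = eval_mpoly (G i)"
    unfolding hform_def by metis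
  with * show "\<exists>V d F. openin zariski V \<and> P \<in> V \<and> V \<subseteq> U \<and> (\<forall>i. homogeneous d (F i)) \<and>
       (\<forall>Q\<in>V. \<forall>v\<in>hom_coords Q. (\<chi> i. eval_mpoly (F i) v) \<in> hom_coords (f Q))"
    by (intro exI[of _ V] exI[of _ d] exI[of _ G]) auto
qed

lemma regular_on_openin: "regular_on U f \<Longrightarrow> openin zariski U"
  by (subst openin_subopen) (metis regular_on_def)

lemma regular_on_local:
  assumes "regular_on U f" "P \<in> U"
  obtains V d F where "openin zariski V" "P \<in> V" "V \<subseteq> U" "\<And>i. hform d (F i)"
    "\<And>Q v. Q \<in> V \<Longrightarrow> v \<in> hom_coords Q \<Longrightarrow> (\<chi> i. F i v) \<in> hom_coords (f Q)"
  using assms unfolding regular_on_hform by metis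

lemma regular_on_id:
  assumes "openin zariski U" "\<And>P. P \<in> U \<Longrightarrow> f P = P"
  shows "regular_on U f"
  unfolding regular_on_hform
proof
  fix P assume "P \<in> U"
  then show "\<exists>V d F. openin zariski V \<and> P \<in> V \<and> V \<subseteq> U \<and> (\<forall>i. hform d (F i)) \<and>
       (\<forall>Q\<in>V. \<forall>v\<in>hom_coords Q. (\<chi> i. F i v) \<in> hom_coords (f Q))"
    using assms hform_coord
    by (intro exI[of _ U] exI[of _ 1] exI[of _ "\<lambda>i v. v $ i"]) auto
qed

text \<open>Locally the preimage of a basic open set is the nonvanishing locus of a composed
  form.\<close>

lemma regular_on_preimage_open:
  assumes "regular_on U f" "openin zariski T"
  shows "openin zariski (U \<inter> f -` T)"
proof (subst openin_subopen, intro ballI)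
  fix P assume P: "P \<in> U \<inter> f -` T"
  then obtain V d F where V: "openin zariski V" "P \<in> V" "V \<subseteq> U" "\<And>i. hform d (F i)"
    and F: "\<And>Q v. Q \<in> V \<Longrightarrow> v \<in> hom_coords Q \<Longrightarrow> (\<chi> i. F i v) \<in> hom_coords (f Q)"
    using regular_on_local[OF assms(1), of P] by blast
  obtain e g where g: "hform e g" "f P \<in> basic_open g" "basic_open g \<subseteq> T"
    using zariski_basis[OF assms(2), of "f P"] P by blast
  define h where "h v = g (\<chi> i. F i v)" for v
  have h: "hform (d * e) h"
    unfolding h_def using g(1) V(4) by (rule hform_compose)
  have *: "Q \<in> basic_open h \<longleftrightarrow> f Q \<in> basic_open g" if "Q \<in> V" for Q
  proof -
    obtain v where "v \<in> hom_coords Q"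
      using hom_coords_nonempty by blast
    then show ?thesis
      using in_basic_open[OF h] in_basic_open[OF g(1) F[OF that]] by (simp add: h_def)
  qed
  show "\<exists>W. openin zariski W \<and> P \<in> W \<and> W \<subseteq> U \<inter> f -` T"
    by (rule exI[of _ "V \<inter> basic_open h"]) (use V g * openin_basic_open[OF h] in auto)
qed

lemma regular_on_compose:
  assumes "regular_on U f" "regular_on V g" "f ` U \<subseteq> V"
  shows "regular_on U (g \<circ> f)"
  unfolding regular_on_hform
proof
  fix P assume P: "P \<in> U"
  obtain A d F where A: "openin zariski A" "P \<in> A" "A \<subseteq> U" "\<And>i. hform d (F i)"
    and F: "\<And>Q v. Q \<in> A \<Longrightarrow> v \<in> hom_coords Q \<Longrightarrow> (\<chi> i. F i v) \<in> hom_coords (f Q)"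
    using regular_on_local[OF assms(1) P] by blast
  have "f P \<in> V"
    using P assms(3) by blast
  then obtain B e G where B: "openin zariski B" "f P \<in> B" "B \<subseteq> V" "\<And>i. hform e (G i)"
    and G: "\<And>Q v. Q \<in> B \<Longrightarrow> v \<in> hom_coords Q \<Longrightarrow> (\<chi> i. G i v) \<in> hom_coords (g Q)"
    using regular_on_local[OF assms(2)] by metis
  have "openin zariski (A \<inter> (U \<inter> f -` B))"
    using A(1) regular_on_preimage_open[OF assms(1) B(1)] by blast
  moreover have "hform (d * e) (\<lambda>v. G i (\<chi> i. F i v))" for i
    using B(4) A(4) by (rule hform_compose)
  ultimately show "\<exists>V d F. openin zariski V \<and> P \<in> V \<and> V \<subseteq> U \<and> (\<forall>i. hform d (F i)) \<and>
       (\<forall>Q\<in>V. \<forall>v\<in>hom_coords Q. (\<chi> i. F i v) \<in> hom_coords ((g \<circ> f) Q))"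
    using A B P F G
    by (intro exI[of _ "A \<inter> (U \<inter> f -` B)"] exI[of _ "d * e"]
          exI[of _ "\<lambda>i v. G i (\<chi> i. F i v)"]) auto
qed

text \<open>Proportionality of \<open>F v\<close> and \<open>v\<close> is the vanishing of 2 by 2
  minors, a closed condition; by irreducibility it spreads from \<open>T\<close> to all of
  \<open>W\<close>.\<close>

lemma regular_on_eq_id:
  assumes "regular_on W h" "openin zariski T" "T \<noteq> {}" "\<And>P. P \<in> T \<inter> W \<Longrightarrow> h P = P"
    and "P \<in> W"
  shows "h P = P"
proof -
  obtain V d F where V: "openin zariski V" "P \<in> V" "V \<subseteq> W" "\<And>i. hform d (F i)"
    and F: "\<And>Q v. Q \<in> V \<Longrightarrow> v \<in> hom_coords Q \<Longrightarrow> (\<chi> i. F i v) \<in> hom_coords (h Q)"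
    using regular_on_local[OF assms(1,5)] by blast
  obtain v where v: "v \<in> hom_coords P"
    using hom_coords_nonempty by blast
  have minor: "F i v * v $ j = F j v * v $ i" for i j
  proof (rule ccontr)
    assume *: "F i v * v $ j \<noteq> F j v * v $ i"
    define m where "m v = F i v * v $ j + (-1) * (F j v * v $ i)" for v
    have m: "hform (d + 1) m"
      unfolding m_def by (intro hform_add hform_mult hform_cmult V hform_coord)
    have "P \<in> basic_open m"
      using * by (simp add: in_basic_open[OF m v] m_def)
    then have "T \<inter> (V \<inter> basic_open m) \<noteq> {}"
      using V(1,2) assms(2,3) openin_basic_open[OF m] by (intro zariski_irreducible) auto
    then obtain Q where Q: "Q \<in> T" "Q \<in> V" "Q \<in> basic_open m"
      by blast
    obtain w where w: "w \<in> hom_coords Q"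
      using hom_coords_nonempty by blast
    have "h Q = Q"
      using Q V(3) assms(4) by blast
    then have "(\<chi> i. F i w) \<in> hom_coords Q"
      using F[OF Q(2) w] by simp
    then obtain c where "(\<chi> i. F i w) = c *s w"
      using w hom_coordsE by blast
    then have "F i w = c * w $ i" "F j w = c * w $ j"
      by (simp_all add: vec_eq_iff)
    then have "m w = 0"
      by (simp add: m_def)
    then show False
      using Q(3) in_basic_open[OF m w] by simp
  qed
  obtain j where j: "v $ j \<noteq> 0"
    using v by (auto simp: hom_coords_iff vec_eq_iff)
  \<comment> \<open>All minors vanish, so the ratio at a nonzero coordinate of \<open>v\<close> is
    the common factor. It is nonzero because \<open>F v\<close> represents a point.\<close>
  have "(\<chi> i. F i v) = (F j v / v $ j) *s v"
    using minor[of _ j] j by (simp add: vec_eq_iff field_simps)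
  moreover have Fv: "(\<chi> i. F i v) \<in> hom_coords (h P)"
    using F V(2) v by blast
  ultimately have "F j v / v $ j \<noteq> 0"
    by (metis hom_coords_iff vector_smult_lzero)
  then have "(\<chi> i. F i v) \<in> hom_coords P"
    using hom_coords_smult[OF v] \<open>(\<chi> i. F i v) = _\<close> by metis
  with Fv show ?thesis
    by (rule hom_coords_unique)
qed


section \<open>Isomorphisms of open sets as birational maps\<close>

lemma isomorphism_between_sym:
  assumes "isomorphism_between U V f"
  obtains g where "isomorphism_between V U g" "\<And>P. P \<in> U \<Longrightarrow> g (f P) = P"
    "\<And>Q. Q \<in> V \<Longrightarrow> f (g Q) = Q"
  using assms unfolding isomorphism_between_def by metis

lemma isomorphism_between_id: "openin zariski U \<Longrightarrow> isomorphism_between U U id"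
  unfolding isomorphism_between_def by (auto intro!: exI[of _ id] regular_on_id)

lemma isomorphism_between_compose:
  assumes "isomorphism_between U V f" "isomorphism_between V W g"
  shows "isomorphism_between U W (g \<circ> f)"
proof -
  obtain f' where f': "regular_on V f'" "f' ` V \<subseteq> U" "\<forall>P\<in>U. f' (f P) = P" "\<forall>Q\<in>V. f (f' Q) = Q"
    using assms(1) unfolding isomorphism_between_def by blast
  obtain g' where g': "regular_on W g'" "g' ` W \<subseteq> V" "\<forall>P\<in>V. g' (g P) = P" "\<forall>Q\<in>W. g (g' Q) = Q"
    using assms(2) unfolding isomorphism_between_def by blast
  have fg: "regular_on U f" "f ` U \<subseteq> V" "regular_on V g" "g ` V \<subseteq> W"
    using assms by (auto simp: isomorphism_between_def)
  show ?thesis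
    unfolding isomorphism_between_def
  proof (intro conjI exI[of _ "f' \<circ> g'"])
    show "regular_on U (g \<circ> f)" "regular_on W (f' \<circ> g')"
      using regular_on_compose fg f' g' by blast+
  qed (use fg f' g' in \<open>auto simp: image_subset_iff\<close>)
qed

lemma rat_eq_class: "(V, g) \<in> rat_eq `` {(U, f)} \<longleftrightarrow>
   (U, f) \<in> rat_pairs \<and> (V, g) \<in> rat_pairs \<and> (\<forall>P\<in>U \<inter> V. f P = g P)"
  by (auto simp: rat_eq_def)

lemma isomorphism_between_rat_pairs:
  "isomorphism_between U V f \<Longrightarrow> U \<noteq> {} \<Longrightarrow> (U, f) \<in> rat_pairs"
  by (auto simp: isomorphism_between_def rat_pairs_def intro: regular_on_openin)

text \<open>The image is the preimage of \<open>T\<close> under the regular inverse.\<close>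

lemma isomorphism_between_image_open:
  assumes "isomorphism_between U V f" "openin zariski T"
  shows "openin zariski (f ` (U \<inter> T))"
proof -
  obtain g where g: "isomorphism_between V U g" "\<And>P. P \<in> U \<Longrightarrow> g (f P) = P"
    "\<And>Q. Q \<in> V \<Longrightarrow> f (g Q) = Q"
    using assms(1) by (rule isomorphism_between_sym) blast
  have "f ` (U \<inter> T) = V \<inter> g -` T"
  proof (intro set_eqI iffI)
    show "Q \<in> V \<inter> g -` T" if "Q \<in> f ` (U \<inter> T)" for Q
      using that assms(1) g(2) by (auto simp: isomorphism_between_def)
    show "Q \<in> f ` (U \<inter> T)" if "Q \<in> V \<inter> g -` T" for Q
      using that g(1,3) by (intro image_eqI[of _ _ "g Q"]) (auto simp: isomorphism_between_def)
  qed
  then show ?thesis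
    using g(1) assms(2) regular_on_preimage_open by (auto simp: isomorphism_between_def)
qed

text \<open>Any representative \<open>h\<close> agrees with \<open>f\<close> on a nonempty open set,
  whose image under \<open>f\<close> is open and so meets every nonempty open set.\<close>

lemma dominant_isomorphism:
  assumes "isomorphism_between U V f" "U \<noteq> {}"
  shows "dominant (rat_eq `` {(U, f)})"
proof -
  have "zariski closure_of (h ` W) = UNIV" if Wh: "(W, h) \<in> rat_eq `` {(U, f)}" for W h
  proof -
    from Wh have W: "openin zariski W" "W \<noteq> {}" and h: "\<forall>P\<in>U \<inter> W. f P = h P"
      unfolding rat_eq_class by (auto simp: rat_pairs_def)
    have U: "openin zariski U"
      using assms(1) regular_on_openin by (auto simp: isomorphism_between_def)
    have ne: "U \<inter> W \<noteq> {}"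
      using U W assms(2) zariski_irreducible by blast
    have "T \<inter> h ` W \<noteq> {}" if "openin zariski T" "T \<noteq> {}" for T
    proof -
      have "T \<inter> f ` (U \<inter> W) \<noteq> {}"
        using zariski_irreducible that isomorphism_between_image_open[OF assms(1) W(1)] ne by blast
      then show ?thesis
        using h by force
    qed
    then show ?thesis
      by (auto simp: in_closure_of topspace_zariski disjoint_iff) blast
  qed
  then show ?thesis
    unfolding dominant_def by blast
qed

text \<open>\<open>rat_comp\<close> ranges over all representatives, but each of their composites is
  the identity on a nonempty open set, and this determines the class.\<close>

lemma rat_comp_isomorphism:
  assumes f: "isomorphism_between U V f" and g: "isomorphism_between V U g"
    and gf: "\<And>P. P \<in> U \<Longrightarrow> g (f P) = P" and "U \<noteq> {}"
  shows "rat_comp (rat_eq `` {(V, g)}) (rat_eq `` {(U, f)}) = rat_id"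
proof (intro set_eqI iffI)
  have U: "openin zariski U" and V: "openin zariski V" and fU: "f ` U \<subseteq> V"
    using f g regular_on_openin by (auto simp: isomorphism_between_def)
  have pairs: "(U, f) \<in> rat_pairs" "(V, g) \<in> rat_pairs"
    using assms fU isomorphism_between_rat_pairs by blast+
  have id: "(UNIV, id) \<in> rat_pairs"
    using regular_on_id[of UNIV id] openin_topspace[of "zariski"]
    by (auto simp: rat_pairs_def topspace_zariski)
  {
    fix x assume "x \<in> rat_comp (rat_eq `` {(V, g)}) (rat_eq `` {(U, f)})"
    then obtain U' f' V' g' where f': "(U', f') \<in> rat_eq `` {(U, f)}"
      and g': "(V', g') \<in> rat_eq `` {(V, g)}"
      and x: "x \<in> rat_eq `` {(U' \<inter> f' -` V', g' \<circ> f')}"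
      by (force simp: rat_comp_def)
    obtain W h where xWh: "x = (W, h)"
      by (cases x)
    have h: "(W, h) \<in> rat_pairs" "\<forall>P\<in>(U' \<inter> f' -` V') \<inter> W. (g' \<circ> f') P = h P"
      using x unfolding xWh rat_eq_class by blast+
    have U': "openin zariski U'" "U' \<noteq> {}" and ff': "\<forall>P\<in>U \<inter> U'. f P = f' P"
      using f' unfolding rat_eq_class by (auto simp: rat_pairs_def)
    have V': "openin zariski V'" "V' \<noteq> {}" and gg': "\<forall>P\<in>V \<inter> V'. g P = g' P"
      using g' unfolding rat_eq_class by (auto simp: rat_pairs_def)
    \<comment> \<open>On \<open>T\<close> the chosen \<open>f'\<close> and \<open>g'\<close> may be
      replaced by \<open>f\<close> and \<open>g\<close>. It is nonempty because the open image of
      \<open>U \<inter> U'\<close> under \<open>f\<close> meets \<open>V'\<close>.\<close>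
    define T where "T = U' \<inter> (U \<inter> f -` V')"
    have "openin zariski T"
      unfolding T_def using f
      by (intro openin_Int U'(1) regular_on_preimage_open V'(1)) (simp only: isomorphism_between_def)
    moreover have "f ` (U \<inter> U') \<inter> V' \<noteq> {}"
      using U U' V' \<open>U \<noteq> {}\<close> isomorphism_between_image_open[OF f U'(1)] zariski_irreducible
      by (metis image_is_empty)
    then have "T \<noteq> {}"
      by (auto simp: T_def)
    moreover have "h P = P" if "P \<in> T \<inter> W" for P
    proof -
      have P: "P \<in> U" "P \<in> U'" "f P \<in> V'" "P \<in> W" "f P \<in> V"
        using that fU by (auto simp: T_def)
      then have "f' P = f P" "g' (f P) = g (f P)"
        using ff' gg' by auto
      moreover from this have "h P = g' (f' P)"
        using P h(2)[rule_format, of P] by simp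
      ultimately show ?thesis
        using P(1) gf by simp
    qed
    ultimately have "h P = P" if "P \<in> W" for P
      using that h(1) regular_on_eq_id[of W h T P] by (auto simp: rat_pairs_def)
    then show "x \<in> rat_id"
      using h(1) id unfolding rat_id_def xWh rat_eq_class by simp
  }
  \<comment> \<open>Conversely, the representatives \<open>(U, f)\<close> and \<open>(V, g)\<close>
    alone already yield every pair in the identity class.\<close>
  fix x assume x: "x \<in> (rat_id :: 'a rat_map)"
  obtain W h where xWh: "x = (W, h)"
    by (cases x)
  have h: "(W, h) \<in> rat_pairs" "\<forall>P\<in>W. h P = P"
    using x by (simp_all add: xWh rat_id_def rat_eq_def)
  have "(U \<inter> f -` V, g \<circ> f) \<in> rat_pairs"
    using U fU gf \<open>U \<noteq> {}\<close> regular_on_id[of U "g \<circ> f"]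
    by (auto simp: rat_pairs_def inf_absorb1 image_subset_iff_subset_vimage)
  then have "x \<in> rat_eq `` {(U \<inter> f -` V, g \<circ> f)}"
    using h gf by (simp add: xWh rat_eq_def)
  moreover have "(U, f) \<in> rat_eq `` {(U, f)}" "(V, g) \<in> rat_eq `` {(V, g)}"
    using pairs by (auto simp: rat_eq_def)
  ultimately show "x \<in> rat_comp (rat_eq `` {(V, g)}) (rat_eq `` {(U, f)})"
    unfolding rat_comp_def by blast
qed

lemma birational_map_isomorphism:
  assumes "isomorphism_between U V f" "U \<noteq> {}"
  shows "birational_map (rat_eq `` {(U, f)})"
proof -
  obtain g where g: "isomorphism_between V U g" "\<And>P. P \<in> U \<Longrightarrow> g (f P) = P"
    "\<And>Q. Q \<in> V \<Longrightarrow> f (g Q) = Q"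
    using assms(1) by (rule isomorphism_between_sym) blast
  have V: "V \<noteq> {}"
    using assms by (auto simp: isomorphism_between_def)
  have "rat_eq `` {(U, f)} \<in> rational_maps" "rat_eq `` {(V, g)} \<in> rational_maps"
    unfolding rational_maps_def using assms g(1) V isomorphism_between_rat_pairs by (blast intro: quotientI)+
  then show ?thesis
    unfolding birational_map_def
    using assms g V dominant_isomorphism rat_comp_isomorphism by metis
qed


section \<open>Shears\<close>

definition lform :: "complex ^ 'n::finite \<Rightarrow> complex ^ 'n \<Rightarrow> complex" where
  "lform k v = (\<Sum>i\<in>UNIV. k $ i * v $ i)"

lemma lform_add: "lform k (v + w) = lform k v + lform k w"
  by (simp add: lform_def distrib_left sum.distrib)

lemma lform_diff: "lform k (v - w) = lform k v - lform k w"
  by (simp add: lform_def right_diff_distrib sum_subtractf)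

lemma lform_smult: "lform k (c *s v) = c * lform k v"
  by (simp add: lform_def sum_distrib_left mult_ac)

lemma lform_0: "lform k 0 = 0"
  by (simp add: lform_def)

text \<open>The pairing involves no conjugation. Its symmetry lets a generic coefficient vector be
  found in the same way as a generic point.\<close>

lemma lform_commute: "lform k v = lform v k"
  by (simp add: lform_def mult.commute)

lemma hform_lform: "hform 1 (lform k)"
  unfolding lform_def[abs_def] by (intro hform_sum hform_cmult hform_coord)

text \<open>A basis of the span of \<open>S\<close> stays independent when \<open>a\<close> is
  adjoined, so a linear map can be prescribed freely on the enlarged set.\<close>

lemma separating_lform:
  fixes a :: "complex ^ 'n::finite"
  assumes "a \<notin> vec.span S"
  shows "\<exists>k. lform k a = 1 \<and> (\<forall>x\<in>S. lform k x = 0)"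
proof -
  obtain B where B: "B \<subseteq> S" "vec.independent B" "S \<subseteq> vec.span B"
    using vec.maximal_independent_subset .
  have "a \<notin> vec.span B"
    using assms B(1) vec.span_mono by blast
  then have "vec.independent (insert a B)"
    using B(2) by (rule vec.independent_insertI)
  \<comment> \<open>The values of \<open>g\<close> are vectors; at \<open>a\<close> it is the
    all-ones vector, so any one coordinate of \<open>g\<close> is the desired functional.\<close>
  then obtain g :: "complex ^ 'n \<Rightarrow> complex ^ 'n" where g: "Vector_Spaces.linear (*s) (*s) g"
    "\<forall>x\<in>insert a B. g x = (if x = a then 1 else 0)"
    using vec.linear_independent_extend[of "insert a B" "\<lambda>x. if x = a then 1 else 0"] by blast
  obtain i :: 'n where True
    by blast
  define k where "k = matrix g $ i"
  have k: "lform k x = g x $ i" for x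
  proof -
    have "lform k x = (matrix g *v x) $ i"
      by (simp add: k_def lform_def matrix_vector_mult_def)
    then show ?thesis
      by (simp only: matrix_works[OF g(1)])
  qed
  have "a \<notin> B"
    using \<open>a \<notin> vec.span B\<close> vec.span_base by blast
  then have "g x = 0" if "x \<in> B" for x
    using g(2) that by auto
  then have "g x = 0" if "x \<in> S" for x
    using vec.linear_eq_0_on_span[OF g(1), of B x] that B(3) by blast
  with k g(2) show ?thesis
    by (intro exI[of _ k]) auto
qed

lemma nonzero_lform:
  assumes "v \<noteq> 0"
  shows "\<exists>k. lform k v \<noteq> 0"
  using separating_lform[of v "{}"] assms by (metis singletonD vec.span_empty zero_neq_one)

lemma abs_proj_in_basic_open: "lform k v \<noteq> 0 \<Longrightarrow> abs_proj v \<in> basic_open (lform k)"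
  by (auto simp: basic_open_def lform_0 intro!: bexI[of _ v] hom_coords_abs_proj)

text \<open>For a form \<open>q\<close> of degree \<open>d + 1\<close> this homogenises the map
  \<open>v + q v *s e\<close> of the chart \<open>l v = 1\<close>: the power of \<open>l\<close>
  brings the first term to the degree of \<open>q\<close>.\<close>

definition shear where
  "shear l d q e v = l v ^ d *s v + q v *s (e :: complex ^ 'n::finite)"

text \<open>As \<open>lform k e = 0\<close>, the value of \<open>lform k\<close> is only raised to
  the power \<open>d + 1\<close>, so the chart is preserved; as \<open>q\<close> is constant along
  \<open>e\<close>, the shear by \<open>- q\<close> undoes the shear by \<open>q\<close>.\<close>

lemma shear_isomorphism:
  fixes e :: "complex ^ 'n::finite"
  assumes "lform k e = 0" and q: "hform (d + 1) q" "\<And>v c. q (v + c *s e) = q v"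
  obtains f where "isomorphism_between (basic_open (lform k)) (basic_open (lform k)) f"
    "\<And>P v. P \<in> basic_open (lform k) \<Longrightarrow> v \<in> hom_coords P \<Longrightarrow> shear (lform k) d q e v \<in> hom_coords (f P)"
proof -
  define A :: "'n proj set" where "A = basic_open (lform k)"
  have A: "openin zariski A" and inA: "\<And>P v. v \<in> hom_coords P \<Longrightarrow> P \<in> A \<longleftrightarrow> lform k v \<noteq> 0"
    unfolding A_def using openin_basic_open in_basic_open hform_lform by blast+
  \<comment> \<open>The point map uses a chosen representative; homogeneity of degree
    \<open>d + 1\<close> makes the choice irrelevant on \<open>A\<close>.\<close>
  define f where "f r P = abs_proj (shear (lform k) d r e (SOME v. v \<in> hom_coords P))" for r P
  have lshear: "lform k (shear (lform k) d r e v) = lform k v ^ (d + 1)" for r v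
    using assms(1) by (simp add: shear_def lform_add lform_smult)
  have f: "shear (lform k) d r e v \<in> hom_coords (f r P)"
    if r: "hform (d + 1) r" and P: "P \<in> A" and v: "v \<in> hom_coords P" for r P v
  proof -
    define w where "w = (SOME w. w \<in> hom_coords P)"
    have w: "w \<in> hom_coords P"
      unfolding w_def using v by (rule someI)
    then have "lform k (shear (lform k) d r e w) \<noteq> 0"
      using P inA by (simp add: lshear)
    then have "shear (lform k) d r e w \<noteq> 0"
      using lform_0 by metis
    then have fw: "shear (lform k) d r e w \<in> hom_coords (f r P)"
      unfolding f_def w_def by (rule hom_coords_abs_proj)
    obtain c where c: "c \<noteq> 0" "v = c *s w"
      using w v by (rule hom_coordsE)
    have "shear (lform k) d r e v = c ^ (d + 1) *s shear (lform k) d r e w"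
      using hform_scale[OF r]
      by (simp add: c(2) shear_def lform_smult vec_eq_iff power_mult_distrib algebra_simps)
    then show ?thesis
      using hom_coords_smult[OF fw] c(1) by simp
  qed
  have fA: "f r ` A \<subseteq> A" if r: "hform (d + 1) r" for r
  proof (rule image_subsetI)
    fix P assume P: "P \<in> A"
    obtain v where v: "v \<in> hom_coords P"
      using hom_coords_nonempty by blast
    show "f r P \<in> A"
      using P inA[OF v] inA[OF f[OF r P v]] by (simp add: lshear)
  qed
  have reg: "regular_on A (f r)" if r: "hform (d + 1) r" for r
    unfolding regular_on_hform
  proof (intro ballI exI conjI allI)
    show "hform (d + 1) (\<lambda>v. lform k v ^ d * v $ i + e $ i * r v)" for i
      using hform_mult[OF hform_power[OF hform_lform[of k], of d] hform_coord[of i]] r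
      by (intro hform_add hform_cmult) auto
    show "(\<chi> i. lform k v ^ d * v $ i + e $ i * r v) \<in> hom_coords (f r Q)"
      if "Q \<in> A" "v \<in> hom_coords Q" for Q v
    proof -
      have "(\<chi> i. lform k v ^ d * v $ i + e $ i * r v) = shear (lform k) d r e v"
        by (simp add: shear_def vec_eq_iff mult.commute)
      then show ?thesis
        using f r that by simp
    qed
  qed (use A in auto)
  have inv: "f (\<lambda>v. - r v) (f r P) = P"
    if r: "hform (d + 1) r" "\<And>v c. r (v + c *s e) = r v" and P: "P \<in> A" for r P
  proof -
    obtain v where v: "v \<in> hom_coords P"
      using hom_coords_nonempty by blast
    let ?w = "shear (lform k) d r e v"
    have r': "hform (d + 1) (\<lambda>v. - r v)"
      using hform_cmult[OF r(1), of "-1"] by simp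
    have "f r P \<in> A"
      using fA[OF r(1)] P by blast
    then have 1: "shear (lform k) d (\<lambda>v. - r v) e ?w \<in> hom_coords (f (\<lambda>v. - r v) (f r P))"
      using f r r' P v by blast
    \<comment> \<open>\<open>K\<close> is both the value of \<open>lform k ?w ^ d\<close> and the
      factor by which \<open>r ?w\<close> differs from \<open>r v\<close>, so the two multiples of
      \<open>e\<close> cancel.\<close>
    define K where "K = lform k v ^ ((d + 1) * d)"
    have "r ?w = K * r v"
      by (simp only: K_def shear_def[of _ d r] r(2) hform_scale[OF r(1)] mult.commute flip: power_mult)
    then have "shear (lform k) d (\<lambda>v. - r v) e ?w = K *s ?w + (- K * r v) *s e"
      unfolding shear_def[of _ _ "\<lambda>v. - r v"] lshear by (simp only: K_def power_mult mult_minus_left)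
    also have "\<dots> = (K * lform k v ^ d) *s v"
      by (simp add: shear_def vec_eq_iff algebra_simps)
    finally have 2: "shear (lform k) d (\<lambda>v. - r v) e ?w = (K * lform k v ^ d) *s v" .
    have "(K * lform k v ^ d) *s v \<in> hom_coords P"
      using v P inA by (intro hom_coords_smult) (auto simp: K_def)
    with 1 show ?thesis
      unfolding 2 by (rule hom_coords_unique)
  qed
  have q': "hform (d + 1) (\<lambda>v. - q v)"
    using hform_cmult[OF q(1), of "-1"] by simp
  \<comment> \<open>The other composite is \<open>inv\<close> applied to \<open>- q\<close>, whose
    negative is \<open>q\<close> again.\<close>
  have "f q (f (\<lambda>v. - q v) P) = P" if "P \<in> A" for P
    using inv[OF q' _ that] q(2) by simp
  then have "isomorphism_between A A (f q)"
    unfolding isomorphism_between_def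
    using reg fA inv q q' by (intro conjI exI[of _ "f (\<lambda>v. - q v)"]) auto
  with that f[OF q(1)] show thesis
    by (auto simp: A_def)
qed

section \<open>Moving finite sets of points inside the affine chart\<close>

text \<open>
  The hypothesis on \<open>\<mu>\<close> says that the line through \<open>a\<close> and \<open>c\<close> misses \<open>F\<close>.  The shear in
  direction \<open>c - a\<close> is scaled by a product of linear forms that are constant on that direction, each
  vanishing at one point of \<open>F\<close>.
\<close>

lemma move_along_line:
  fixes a c :: "complex ^ 'n::finite"
  assumes "finite F" and l: "lform k a = 1" "lform k c = 1" "\<And>x. x \<in> F \<Longrightarrow> lform k x = 1"
    and "a \<notin> F" and \<mu>: "\<And>x. x \<in> F \<Longrightarrow> \<exists>\<mu>. lform \<mu> a = 0 \<and> lform \<mu> x = 0 \<and> lform \<mu> c \<noteq> 0"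
  obtains f where "isomorphism_between (basic_open (lform k)) (basic_open (lform k)) f"
    "f (abs_proj a) = abs_proj c" "\<And>x. x \<in> F \<Longrightarrow> f (abs_proj x) = abs_proj x"
proof -
  \<comment> \<open>This provides a form that is 1 at \<open>a\<close>, constant along
    \<open>c - a\<close> and zero at \<open>x\<close>. In a linear relation, \<open>\<mu>\<close>
    forces \<open>\<alpha> = 0\<close>, and comparing values of \<open>lform k\<close> forces
    \<open>\<beta> = 1\<close>.\<close>
  have "a \<notin> vec.span {c - a, x}" if x: "x \<in> F" for x
  proof
    assume "a \<in> vec.span {c - a, x}"
    then obtain \<alpha> \<beta> where "a - \<alpha> *s (c - a) = \<beta> *s x"
      by (auto simp: vec.span_breakdown_eq)
    then have a: "a = \<alpha> *s (c - a) + \<beta> *s x"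
      by (metis add.commute diff_add_cancel)
    have lin: "\<alpha> * (lform m c - lform m a) + \<beta> * lform m x = lform m a" for m
      using arg_cong[OF a, of "lform m", symmetric] by (simp only: lform_add lform_diff lform_smult)
    obtain \<mu> where "lform \<mu> a = 0" "lform \<mu> x = 0" "lform \<mu> c \<noteq> 0"
      using \<mu> x by blast
    then have "\<alpha> = 0"
      using lin[of \<mu>] by simp
    moreover have "\<beta> = 1"
      using lin[of k] l x by simp
    ultimately have "a = x"
      using a by simp
    with x \<open>a \<notin> F\<close> show False
      by simp
  qed
  then have "\<exists>m. lform m a = 1 \<and> lform m (c - a) = 0 \<and> lform m x = 0" if "x \<in> F" for x
    using that separating_lform[of a "{c - a, x}"] by simp
  then obtain m where m: "\<And>x. x \<in> F \<Longrightarrow> lform (m x) a = 1 \<and> lform (m x) (c - a) = 0 \<and> lform (m x) x = 0"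
    by metis
  define d where "d = card F"
  \<comment> \<open>The extra factor \<open>lform k v\<close> raises the degree from
    \<open>card F\<close> to \<open>d + 1\<close> and is 1 at all normalised vectors.\<close>
  define q where "q v = (\<Prod>x\<in>F. lform (m x) v) * lform k v" for v
  have "hform (d + 1) q"
    unfolding q_def d_def using hform_prod[of F "\<lambda>_. 1" "\<lambda>x. lform (m x)"] hform_lform
    by (intro hform_mult) auto
  moreover have "q (v + t *s (c - a)) = q v" for v t
    using m l by (simp add: q_def lform_add lform_smult lform_diff)
  moreover have ke: "lform k (c - a) = 0"
    using l by (simp add: lform_diff)
  ultimately obtain f where iso: "isomorphism_between (basic_open (lform k)) (basic_open (lform k)) f"
    and f: "\<And>P v. P \<in> basic_open (lform k) \<Longrightarrow> v \<in> hom_coords P \<Longrightarrow>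
        shear (lform k) d q (c - a) v \<in> hom_coords (f P)"
    using shear_isomorphism by metis
  have f': "f (abs_proj v) = abs_proj (v + q v *s (c - a))" if "lform k v = 1" for v
  proof -
    have "v \<noteq> 0"
      using that by (auto simp: lform_0)
    then show ?thesis
      using f[of "abs_proj v" v] that
      by (simp add: shear_def hom_coords_iff abs_proj_in_basic_open)
  qed
  \<comment> \<open>Hence \<open>a\<close> goes to \<open>a + (c - a) = c\<close>, while each point
    of \<open>F\<close> is a zero of its own factor and stays fixed.\<close>
  have "q a = 1"
    using m l by (simp add: q_def)
  moreover have "q x = 0" if "x \<in> F" for x
    using that m \<open>finite F\<close> by (auto simp: q_def)
  ultimately show thesis
    using that[OF iso] f' l by simp
qed

lemma move_point:
  fixes a b :: "complex ^ 'n::finite"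
  assumes "CARD('n) \<ge> 3" "finite F" and l: "lform k a = 1" "lform k b = 1" "\<And>x. x \<in> F \<Longrightarrow> lform k x = 1"
    and "a \<notin> F" "b \<notin> F"
  obtains f where "isomorphism_between (basic_open (lform k)) (basic_open (lform k)) f"
    "f (abs_proj a) = abs_proj b" "\<And>x. x \<in> F \<Longrightarrow> f (abs_proj x) = abs_proj x"
proof -
  \<comment> \<open>Two vectors span a proper subspace since there are at least three coordinates;
    here the bound on the dimension enters.\<close>
  have "\<exists>\<mu>. lform \<mu> u = 0 \<and> lform \<mu> x = 0 \<and> \<mu> \<noteq> 0" for u x :: "complex ^ 'n"
  proof -
    have "vec.dim {u, x} \<le> 2"
      using vec.dim_le_card'[of "{u, x}"] card_insert_le_m1[of 2 "{x}" u] by simp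
    then have "vec.dim (vec.span {u, x}) < vec.dim (UNIV :: (complex ^ 'n) set)"
      using assms(1) unfolding vec.dim_span vec_dim_card by linarith
    then have "vec.span {u, x} \<noteq> UNIV"
      by (metis less_irrefl)
    then obtain y where "y \<notin> vec.span {u, x}"
      by blast
    then obtain \<mu> where "lform \<mu> y = 1" "lform \<mu> u = 0" "lform \<mu> x = 0"
      using separating_lform[of y "{u, x}"] by auto
    then show ?thesis
      by (metis lform_0 lform_commute zero_neq_one)
  qed
  then obtain \<mu> where \<mu>: "\<And>u x. lform (\<mu> u x) u = 0 \<and> lform (\<mu> u x) x = 0 \<and> \<mu> u x \<noteq> (0 :: complex ^ 'n)"
    by metis
  \<comment> \<open>Nonvanishing of \<open>k\<close> allows \<open>c\<close> to be normalised;
    nonvanishing of \<open>\<mu> u x\<close> keeps \<open>c\<close> off the line through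
    \<open>u\<close> and \<open>x\<close>, so that the line from \<open>u\<close> to
    \<open>c\<close> misses \<open>x\<close>.\<close>
  define K where "K = insert k ((\<lambda>(u, x). \<mu> u x) ` ({a, b} \<times> F))"
  have "k \<noteq> 0"
    using l by (metis lform_0 lform_commute zero_neq_one)
  then have "0 \<notin> K"
    using \<mu> by (auto simp: K_def)
  then have "\<exists>v. \<forall>\<kappa>\<in>K. lform \<kappa> v \<noteq> 0"
    using \<open>finite F\<close>
    by (intro hform_finite_common_nonzero[where d = "\<lambda>_. 1"] hform_lform)
       (metis K_def finite.intros finite_SigmaI finite_imageI, metis nonzero_lform lform_commute)
  then obtain v where v: "\<And>\<kappa>. \<kappa> \<in> K \<Longrightarrow> lform \<kappa> v \<noteq> 0"
    by blast
  define c where "c = inverse (lform k v) *s v"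
  have c: "lform k c = 1" and cK: "\<And>\<kappa>. \<kappa> \<in> K \<Longrightarrow> lform \<kappa> c \<noteq> 0"
    using v by (auto simp: c_def lform_smult K_def)
  have mu: "\<exists>\<mu>. lform \<mu> u = 0 \<and> lform \<mu> x = 0 \<and> lform \<mu> c \<noteq> 0" if "u \<in> {a, b}" "x \<in> F" for u x
  proof -
    have "\<mu> u x \<in> K"
      using that by (auto simp: K_def)
    with \<mu> cK show ?thesis
      by blast
  qed
  obtain f where f: "isomorphism_between (basic_open (lform k)) (basic_open (lform k)) f"
    "f (abs_proj a) = abs_proj c" "\<And>x. x \<in> F \<Longrightarrow> f (abs_proj x) = abs_proj x"
    using move_along_line[OF \<open>finite F\<close> l(1) c l(3) \<open>a \<notin> F\<close> mu] by blast
  obtain g where g: "isomorphism_between (basic_open (lform k)) (basic_open (lform k)) g"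
    "g (abs_proj b) = abs_proj c" "\<And>x. x \<in> F \<Longrightarrow> g (abs_proj x) = abs_proj x"
    using move_along_line[OF \<open>finite F\<close> l(2) c l(3) \<open>b \<notin> F\<close> mu] by blast
  \<comment> \<open>Both \<open>a\<close> and \<open>b\<close> are sent to \<open>c\<close>; the
    inverse of \<open>g\<close> then brings \<open>c\<close> back to \<open>b\<close>, with
    \<open>F\<close> fixed throughout.\<close>
  obtain h where h: "isomorphism_between (basic_open (lform k)) (basic_open (lform k)) h"
    "\<And>P. P \<in> basic_open (lform k) \<Longrightarrow> h (g P) = P"
    using isomorphism_between_sym[OF g(1)] by metis
  have A: "abs_proj x \<in> basic_open (lform k)" if "lform k x = 1" for x
    using that by (simp add: abs_proj_in_basic_open)
  show thesis
  proof
    show "isomorphism_between (basic_open (lform k)) (basic_open (lform k)) (h \<circ> f)"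
      using f(1) h(1) by (rule isomorphism_between_compose)
    show "(h \<circ> f) (abs_proj a) = abs_proj b"
      using f(2) g(2) h(2)[OF A[OF l(2)]] by simp
    show "(h \<circ> f) (abs_proj x) = abs_proj x" if "x \<in> F" for x
      using f(3)[OF that] g(3)[OF that] h(2)[OF A[OF l(3)[OF that]]] by simp
  qed
qed

text \<open>Induction on the number of points of \<open>Z\<close> outside \<open>Z'\<close>: one of
  them is moved to a missing point of \<open>Z'\<close> while the rest of \<open>Z\<close> stays
  fixed.\<close>

lemma transitive_on_finite_sets:
  fixes Z Z' :: "'n::finite proj set"
  assumes "CARD('n) \<ge> 3" "finite Z" "finite Z'" "card Z = card Z'"
    and "Z \<subseteq> basic_open (lform k)" "Z' \<subseteq> basic_open (lform k)"
  shows "\<exists>f. isomorphism_between (basic_open (lform k)) (basic_open (lform k)) f \<and> f ` Z = Z'"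
  using assms(2-)
proof (induction "card (Z - Z')" arbitrary: Z)
  case 0
  then have "Z = Z'"
    by (simp add: card_subset_eq)
  show ?case
  proof (intro exI conjI)
    show "isomorphism_between (basic_open (lform k)) (basic_open (lform k)) id"
      by (rule isomorphism_between_id[OF openin_basic_open[OF hform_lform]])
    show "id ` Z = Z'"
      using \<open>Z = Z'\<close> by simp
  qed
next
  case (Suc n)
  \<comment> \<open>Points of the chart get representatives normalised by
    \<open>lform k v = 1\<close>, as \<open>move_point\<close> expects.\<close>
  have "\<exists>v. v \<in> hom_coords P \<and> lform k v = 1" if P: "P \<in> basic_open (lform k)" for P
  proof -
    obtain v where v: "v \<in> hom_coords P" "lform k v \<noteq> 0"
      using P by (auto simp: basic_open_def)
    then have "inverse (lform k v) *s v \<in> hom_coords P"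
      by (intro hom_coords_smult) auto
    then show ?thesis
      using v by (auto simp: lform_smult)
  qed
  then obtain \<rho> where \<rho>: "\<And>P. P \<in> basic_open (lform k) \<Longrightarrow> abs_proj (\<rho> P) = P \<and> lform k (\<rho> P) = 1"
    by (metis hom_coords_iff)
  obtain a where a: "a \<in> Z" "a \<notin> Z'"
    using Suc.hyps(2) by (metis Diff_iff card.empty ex_in_conv nat.distinct(1))
  \<comment> \<open>If \<open>Z'\<close> were contained in \<open>Z\<close>, equal cardinalities
    would give \<open>Z' = Z\<close>, contradicting the choice of \<open>a\<close>.\<close>
  obtain b where b: "b \<in> Z'" "b \<notin> Z"
    using a Suc.prems by (metis card_subset_eq subsetI)
  define F where "F = Z - {a}"
  have F: "F \<subseteq> basic_open (lform k)" "a \<in> basic_open (lform k)" "b \<in> basic_open (lform k)"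
    using a b Suc.prems by (auto simp: F_def)
  have "\<rho> P \<notin> \<rho> ` F" if "P \<in> basic_open (lform k)" "P \<notin> F" for P
    using that F \<rho> by (metis imageE subsetD)
  then have "\<rho> a \<notin> \<rho> ` F" "\<rho> b \<notin> \<rho> ` F"
    using F b by (auto simp: F_def)
  moreover have "finite (\<rho> ` F)"
    using Suc.prems by (auto simp: F_def)
  moreover have "lform k (\<rho> a) = 1" "lform k (\<rho> b) = 1" "\<And>x. x \<in> \<rho> ` F \<Longrightarrow> lform k x = 1"
    using \<rho> F by auto
  ultimately obtain f where f: "isomorphism_between (basic_open (lform k)) (basic_open (lform k)) f"
    "f (abs_proj (\<rho> a)) = abs_proj (\<rho> b)" "\<And>x. x \<in> \<rho> ` F \<Longrightarrow> f (abs_proj x) = abs_proj x"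
    using move_point[OF assms(1), of "\<rho> ` F" k "\<rho> a" "\<rho> b"] by blast
  have "f P = P" if "P \<in> F" for P
    using f(3)[of "\<rho> P"] \<rho> F(1) that by (metis imageI subsetD)
  moreover have "f a = b"
    using f(2) \<rho> F by simp
  ultimately have fZ: "f ` Z = insert b F"
    using a by (force simp: F_def)
  have n: "insert b F - Z' = (Z - Z') - {a}"
    using b by (auto simp: F_def)
  have "n = card (insert b F - Z')"
    unfolding n using Suc.hyps(2) Suc.prems(1) a by simp
  moreover have "finite (insert b F)" "card (insert b F) = card Z'"
    using Suc.prems a b card_Suc_Diff1[of Z a] by (auto simp: F_def simp del: card_Diff_insert)
  ultimately obtain g where "isomorphism_between (basic_open (lform k)) (basic_open (lform k)) g"
    "g ` insert b F = Z'"
    using Suc.hyps(1)[of "insert b F"] Suc.prems F by auto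
  then have "isomorphism_between (basic_open (lform k)) (basic_open (lform k)) (g \<circ> f)"
    "(g \<circ> f) ` Z = Z'"
    using f(1) fZ isomorphism_between_compose by (blast, metis image_comp)
  then show ?case
    by blast
qed

text \<open>Avoiding a point with representative \<open>v\<close> means
  \<open>lform v k \<noteq> 0\<close>, a nonzero linear condition on \<open>k\<close>, so a generic
  \<open>k\<close> works.\<close>

lemma hyperplane_avoiding_finite:
  fixes S :: "'n::finite proj set"
  assumes "finite S"
  obtains k where "S \<subseteq> basic_open (lform k)" "k \<noteq> 0"
proof -
  obtain \<rho> :: "'n proj \<Rightarrow> complex ^ 'n" where \<rho>: "\<And>P. \<rho> P \<in> hom_coords P"
    using hom_coords_nonempty by metis
  \<comment> \<open>The extra all-ones vector rules out \<open>k = 0\<close> even when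
    \<open>S\<close> is empty.\<close>
  define I where "I = insert 1 (\<rho> ` S)"
  have "0 \<notin> I"
    using \<rho> by (auto simp: I_def hom_coords_iff vec_eq_iff) (metis zero_index)
  then have "\<exists>k. \<forall>v\<in>I. lform v k \<noteq> 0"
    using assms
    by (intro hform_finite_common_nonzero[where d = "\<lambda>_. 1"] hform_lform)
       (simp add: I_def, metis nonzero_lform lform_commute)
  then obtain k where k: "\<And>v. v \<in> I \<Longrightarrow> lform k v \<noteq> 0"
    using lform_commute by metis
  show thesis
  proof
    show "S \<subseteq> basic_open (lform k)"
      using \<rho> k unfolding I_def basic_open_def by blast
    show "k \<noteq> 0"
      using k[of 1] by (auto simp: I_def lform_def)
  qed
qed

section \<open>The birational map carrying one finite set to the other\<close>

theorem theorem3p11: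
  fixes r s :: nat and Z Z' :: "'n::finite proj set"
  assumes "CARD('n) = r + 1" and "r \<ge> 2"
    and "finite Z" and "card Z = s"
    and "finite Z'" and "card Z' = s"
  shows "\<exists>\<omega>. birational_map \<omega> \<and> isomorphism_near \<omega> Z \<and> rat_image \<omega> Z = Z'"
proof -
  obtain k :: "complex ^ 'n" where k: "Z \<union> Z' \<subseteq> basic_open (lform k)" "k \<noteq> 0"
    using hyperplane_avoiding_finite[of "Z \<union> Z'"] assms by auto
  define A where "A = basic_open (lform k)"
  obtain f where f: "isomorphism_between A A f" "f ` Z = Z'"
    using transitive_on_finite_sets[of Z Z' k] assms k(1) unfolding A_def by auto
  \<comment> \<open>The chart is nonempty because \<open>k \<noteq> 0\<close>, so the case of empty
    \<open>Z\<close> is included.\<close>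
  obtain v where "lform k v \<noteq> 0"
    using nonzero_lform[OF k(2)] lform_commute[of k] by auto
  then have "abs_proj v \<in> A"
    unfolding A_def by (rule abs_proj_in_basic_open)
  then have A: "A \<noteq> {}" "openin zariski A"
    using openin_basic_open[OF hform_lform] by (auto simp: A_def)
  define \<omega> where "\<omega> = rat_eq `` {(A, f)}"
  have \<omega>: "(A, f) \<in> \<omega>"
    using isomorphism_between_rat_pairs[OF f(1) A(1)] by (simp add: \<omega>_def rat_eq_def)
  have "birational_map \<omega>"
    unfolding \<omega>_def using f(1) A(1) by (rule birational_map_isomorphism)
  moreover have "isomorphism_near \<omega> Z"
    unfolding isomorphism_near_def using A(2) \<omega> f(1) k(1) A_def by blast
  \<comment> \<open>\<open>rat_image\<close> collects the values of all representatives; each agrees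
    with \<open>f\<close> on the common domain, and \<open>f\<close> is defined on all of
    \<open>Z\<close>.\<close>
  moreover have "g ` (U \<inter> Z) \<subseteq> Z'" if "(U, g) \<in> \<omega>" for U g
  proof (rule image_subsetI)
    fix P assume P: "P \<in> U \<inter> Z"
    then have "P \<in> A"
      using k(1) by (auto simp: A_def)
    then have "f P = g P"
      using that P unfolding \<omega>_def rat_eq_class by blast
    then show "g P \<in> Z'"
      using P f(2) by (metis IntD2 imageI)
  qed
  then have "rat_image \<omega> Z = Z'"
  proof (intro equalityI)
    have "Z' = f ` (A \<inter> Z)"
      using f(2) k(1) by (simp add: A_def inf_absorb2)
    then show "Z' \<subseteq> rat_image \<omega> Z"
      using \<omega> by (auto simp: rat_image_def)
  qed (auto simp: rat_image_def)
  ultimately show ?thesis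
    by blast
qed

end
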